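(* Let $X$ be a linearly ordered set with $|X|\geq 4$. Then there exists no transitive binary relation $\succeq$ on $\mathcal{X}=2^X\setminus\{\emptyset\}$ satisfying simple dominance (SDom), independence (IND), simple uncertainty aversion (SUAv), and simple top monotonicity (STopMon).
   Context: $X$ is linearly ordered by $\dot{\geq}$ (reflexive, complete, transitive, antisymmetric), with strict part $x\mathrel{\dot{>}}y$ iff $x\mathrel{\dot{\geq}}y$ and not $y\mathrel{\dot{\geq}}x$. $\mathcal{X}=2^X\setminus\{\emptyset\}$ is the set of nonempty subsets of $X$. For a binary relation $\succeq$ on $\mathcal{X}$, $A\succ B$ means $A\succeq B$ and not $B\succeq A$. The axioms are: - (SDom) for all $x,y\in X$: $x\mathrel{\dot{>}}y$ implies $\{x\}\succ\{x,y\}$ and $\{x,y\}\succ\{y\}$. - (IND) for all $A,B\in\mathcal{X}$ and all $x\in X\setminus(A\cup B)$: $A\succ B$ implies $A\cup\{x\}\succeq B\cup\{x\}$. - (SUAv) for all $x,y,z\in X$: $x\mathrel{\dot{>}}y$ and $y\mathrel{\dot{>}}z$ imply $\{y\}\succ\{x,z\}$. - (STopMon) for all $x,y,z\in X$ such that $x\mathrel{\dot{>}}z$ and $y\mathrel{\dot{>}}z$: $x\mathrel{\dot{>}}y$ implies $\{x,z\}\succ\{y,z\}$. *)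

theory Defs
  imports Main
begin

text \<open>
  Throughout, \<open>(x, y) \<in> geq\<close> reads ``\<open>x\<close> is at least as good as \<open>y\<close>'' for the linear order on
  the set \<open>X\<close>, and \<open>(A, B) \<in> R\<close> reads ``\<open>A\<close> is at least as good as \<open>B\<close>'' for the relation on
  nonempty subsets of \<open>X\<close>. As \<open>linear_order_on\<close> is invariant under converse, it applies to
  the ``at least'' orientation unchanged.
\<close>

definition strict :: "'b rel \<Rightarrow> 'b \<Rightarrow> 'b \<Rightarrow> bool" where
  "strict R a b \<longleftrightarrow> (a, b) \<in> R \<and> (b, a) \<notin> R"

definition nonempty_subsets :: "'a set \<Rightarrow> 'a set set" where
  "nonempty_subsets X = Pow X - {{}}"

definition SDom :: "'a set \<Rightarrow> 'a rel \<Rightarrow> 'a set rel \<Rightarrow> bool" where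
  "SDom X geq R \<longleftrightarrow>
    (\<forall>x\<in>X. \<forall>y\<in>X. strict geq x y \<longrightarrow> strict R {x} {x, y} \<and> strict R {x, y} {y})"

definition IND :: "'a set \<Rightarrow> 'a set rel \<Rightarrow> bool" where
  "IND X R \<longleftrightarrow>
    (\<forall>A\<in>nonempty_subsets X. \<forall>B\<in>nonempty_subsets X. \<forall>x\<in>X - (A \<union> B).
      strict R A B \<longrightarrow> (A \<union> {x}, B \<union> {x}) \<in> R)"

definition SUAv :: "'a set \<Rightarrow> 'a rel \<Rightarrow> 'a set rel \<Rightarrow> bool" where
  "SUAv X geq R \<longleftrightarrow>
    (\<forall>x\<in>X. \<forall>y\<in>X. \<forall>z\<in>X. strict geq x y \<and> strict geq y z \<longrightarrow> strict R {y} {x, z})"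

definition STopMon :: "'a set \<Rightarrow> 'a rel \<Rightarrow> 'a set rel \<Rightarrow> bool" where
  "STopMon X geq R \<longleftrightarrow>
    (\<forall>x\<in>X. \<forall>y\<in>X. \<forall>z\<in>X. strict geq x z \<and> strict geq y z \<longrightarrow>
      strict geq x y \<longrightarrow> strict R {x, z} {y, z})"

end

theory Submission
  imports Defs
begin

text \<open>
  For \<open>a > b > c > d\<close>, adding \<open>d\<close> to \<open>{b} \<succ> {a, c}\<close> and \<open>a\<close> to \<open>{c, d} \<succ> {d}\<close> yields
  \<open>{b, d} \<succeq> {a, c, d} \<succeq> {a, d}\<close>, which contradicts \<open>{a, d} \<succ> {b, d}\<close>.
\<close>

text \<open>Induction on \<open>S\<close>: a new \<open>x\<close> is compared with the greatest
  element \<open>m\<close> found so far. Totality and antisymmetry make one of them strictly better,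
  and the winner is greatest in the enlarged set.\<close>

lemma finite_greatest_strict:
  assumes "finite S" "S \<noteq> {}" "S \<subseteq> X" "linear_order_on X r"
  shows "\<exists>m\<in>S. \<forall>y\<in>S - {m}. strict r m y"
  using assms(1-3)
proof (induction S rule: finite_ne_induct)
  case (singleton x)
  then show ?case by simp
next
  case (insert x F)
  have tr: "trans r" and tot: "total_on X r" and anti: "antisym r"
    using assms(4) by (auto simp: order_on_defs)
  obtain m where m: "m \<in> F" "\<forall>y\<in>F - {m}. strict r m y"
    using insert by auto
  have "x \<in> X" "m \<in> X" "x \<noteq> m"
    using insert m by auto
  then have "strict r x m \<or> strict r m x"
    using tot anti unfolding total_on_def strict_def by (metis antisymD)
  then show ?case
  proof
    assume "strict r x m"
    \<comment> \<open>For \<open>y\<close> other than \<open>m\<close>, \<open>(y, x)\<close> in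
      \<open>r\<close> together with \<open>(x, m)\<close> would give \<open>(y, m)\<close>, against
      \<open>strict r m y\<close>.\<close>
    then have "strict r x y" if "y \<in> F" for y
      using that m tr unfolding strict_def by (metis DiffI singletonD transD)
    then show ?thesis by auto
  next
    assume "strict r m x"
    then show ?thesis using m by auto
  qed
qed

text \<open>Greatest elements are peeled off a four-element subset one by one. Each beats everything
  left, so all six comparisons come out directly. The case \<open>infinite X\<close> is listed
  separately because \<open>card\<close> is 0 on infinite sets.\<close>

lemma four_chain:
  assumes "linear_order_on X r" "infinite X \<or> card X \<ge> 4"
  obtains a b c d where "a \<in> X" "b \<in> X" "c \<in> X" "d \<in> X"
    "strict r a b" "strict r b c" "strict r c d" "strict r a c" "strict r a d" "strict r b d"
proof -
  obtain S where S: "S \<subseteq> X" "finite S" "card S = 4"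
    using assms(2) by (meson infinite_arbitrarily_large obtain_subset_with_card_n)
  \<comment> \<open>The single condition \<open>card T > 0\<close> encodes both finiteness and
    nonemptiness of \<open>T\<close>.\<close>
  have step: "\<exists>m\<in>T. \<forall>y\<in>T - {m}. strict r m y" if "T \<subseteq> S" "card T > 0" for T
    using that S assms(1) by (intro finite_greatest_strict) (auto dest: card_gt_0_iff[THEN iffD1])
  obtain a where a: "a \<in> S" "\<forall>y\<in>S - {a}. strict r a y"
    using step[of S] S by auto
  have "card (S - {a}) = 3"
    using S a by simp
  then obtain b where b: "b \<in> S - {a}" "\<forall>y\<in>S - {a} - {b}. strict r b y"
    using step[of "S - {a}"] by auto
  have "card (S - {a} - {b}) = 2"
    using \<open>card (S - {a}) = 3\<close> b(1) by (subst card_Diff_singleton) auto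
  then obtain c where c: "c \<in> S - {a} - {b}" "\<forall>y\<in>S - {a} - {b} - {c}. strict r c y"
    using step[of "S - {a} - {b}"] by auto
  have "card (S - {a} - {b} - {c}) = 1"
    using \<open>card (S - {a} - {b}) = 2\<close> c(1) by (subst card_Diff_singleton) auto
  then obtain d where d: "d \<in> S - {a} - {b} - {c}"
    by (metis card.empty all_not_in_conv zero_neq_one)
  show thesis
    using that[of a b c d] a b c d S(1) by blast
qed

theorem theorem3:
  fixes X :: "'a set" and geq :: "'a rel"
  assumes "linear_order_on X geq"
    and "infinite X \<or> card X \<ge> 4"
  shows "\<not> (\<exists>R :: 'a set rel. R \<subseteq> nonempty_subsets X \<times> nonempty_subsets X \<and> trans R \<and>
           SDom X geq R \<and> IND X R \<and> SUAv X geq R \<and> STopMon X geq R)"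
proof
  assume "\<exists>R :: 'a set rel. R \<subseteq> nonempty_subsets X \<times> nonempty_subsets X \<and> trans R \<and>
           SDom X geq R \<and> IND X R \<and> SUAv X geq R \<and> STopMon X geq R"
  then obtain R where R: "trans R" "SDom X geq R" "IND X R" "SUAv X geq R" "STopMon X geq R"
    by blast
  obtain a b c d where X: "a \<in> X" "b \<in> X" "c \<in> X" "d \<in> X"
    and ord: "strict geq a b" "strict geq b c" "strict geq c d"
      "strict geq a c" "strict geq a d" "strict geq b d"
    using four_chain[OF assms] .
  \<comment> \<open>Distinctness will supply the side condition of \<open>IND\<close> that the added
    element lies outside both sets.\<close>
  have ne: "a \<noteq> b" "b \<noteq> c" "c \<noteq> d" "a \<noteq> c" "a \<noteq> d" "b \<noteq> d"
    using ord by (auto simp: strict_def)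
  have ind: "(A \<union> {x}, B \<union> {x}) \<in> R"
    if "strict R A B" "A \<in> nonempty_subsets X" "B \<in> nonempty_subsets X" "x \<in> X - (A \<union> B)"
    for A B x
    using R(3) that unfolding IND_def by blast
  have "strict R {b} {a, c}"
    using R(4) X ord unfolding SUAv_def by blast
  then have "({b} \<union> {d}, {a, c} \<union> {d}) \<in> R"
    using X ne by (intro ind) (auto simp: nonempty_subsets_def)
  moreover have "strict R {c, d} {d}"
    using R(2) X ord unfolding SDom_def by blast
  then have "({c, d} \<union> {a}, {d} \<union> {a}) \<in> R"
    using X ne by (intro ind) (auto simp: nonempty_subsets_def)
  \<comment> \<open>Both extensions meet in the same set, the middle term for transitivity.\<close>
  moreover have "{a, c} \<union> {d} = {c, d} \<union> {a}" "{b} \<union> {d} = {b, d}" "{d} \<union> {a} = {a, d}"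
    by auto
  ultimately have "({b, d}, {a, d}) \<in> R"
    using R(1) by (metis transD)
  \<comment> \<open>\<open>IND\<close> yields only weak comparisons, but a weak one suffices here:
    the strict relation excludes its converse.\<close>
  moreover have "strict R {a, d} {b, d}"
    using R(5) X ord unfolding STopMon_def by blast
  ultimately show False
    by (simp add: strict_def)
qed

end
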